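(* Let $E$ be a normed space and let $T:E\to E$ be a linear isometry (not assumed surjective). Let $D\subset E\setminus\{0_{E}\}$ consist of eigenvectors of $T$ and be such that $\overline{\mathrm{span}\,D}=E$. Then there is $\lambda\in\mathbb{C}$ with $|\lambda|=1$ such that $T=\lambda\,\mathrm{Id}_{E}$, provided that one of the following conditions is satisfied: (i) $D$ is connected in the norm topology; (ii) $D$ is weakly connected (connected in the weak topology of $E$) and for each $e\in D$ the set $\{\nu\in\overline{B}_{E^{*}}:\ \langle e,\nu\rangle=\|e\|\}$ is of finite dimension; (iii) $D$ is bounded and weakly connected, and $E^{*}$ is separable and nearly strictly convex.
   Context: Normed spaces are over $\mathbb{C}$ and not assumed complete. $\overline{B}_{E^{*}}$ is the closed unit ball of the dual $E^{*}$. A subset of a linear space is of finite dimension if its linear span is finite-dimensional. A normed space $F$ is nearly strictly convex if every convex subset of its unit sphere is precompact (totally bounded) in $F$. *)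

theory Defs
  imports "HOL-Analysis.Analysis"
begin

class complex_normed_vector = real_normed_vector +
  fixes scaleC :: "complex \<Rightarrow> 'a \<Rightarrow> 'a"  (infixr \<open>*\<^sub>C\<close> 75)
  assumes scaleC_add_right: "c *\<^sub>C (x + y) = c *\<^sub>C x + c *\<^sub>C y"
    and scaleC_add_left: "(c + d) *\<^sub>C x = c *\<^sub>C x + d *\<^sub>C x"
    and scaleC_scaleC: "c *\<^sub>C d *\<^sub>C x = (c * d) *\<^sub>C x"
    and scaleC_one: "1 *\<^sub>C x = x"
    and scaleR_scaleC: "r *\<^sub>R x = complex_of_real r *\<^sub>C x"
    and norm_scaleC: "norm (c *\<^sub>C x) = cmod c * norm x"

global_interpretation complex_vector:
  vector_space "scaleC :: complex \<Rightarrow> 'a \<Rightarrow> 'a::complex_normed_vector"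
  defines cspan = complex_vector.span
  by standard (rule scaleC_add_right scaleC_add_left scaleC_scaleC scaleC_one)+

abbreviation clinear :: "('a::complex_normed_vector \<Rightarrow> 'b::complex_normed_vector) \<Rightarrow> bool"
  where "clinear \<equiv> Vector_Spaces.linear scaleC scaleC"

lemma clinear_iff:
  "clinear f \<longleftrightarrow> (\<forall>x y. f (x + y) = f x + f y) \<and> (\<forall>c x. f (c *\<^sub>C x) = c *\<^sub>C f x)"
  unfolding Vector_Spaces.linear_iff
  by (simp add: complex_vector.vector_space_axioms)

instantiation complex :: complex_normed_vector
begin

definition scaleC_complex :: "complex \<Rightarrow> complex \<Rightarrow> complex"
  where "scaleC_complex c z = c * z"

instance
  by standard (simp_all add: scaleC_complex_def algebra_simps norm_mult scaleR_conv_of_real)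

end

definition finite_dimensional :: "'a::complex_normed_vector set \<Rightarrow> bool"
  where "finite_dimensional S \<longleftrightarrow> (\<exists>B. finite B \<and> cspan S = cspan B)"

definition eigenvector :: "('a::complex_normed_vector \<Rightarrow> 'a) \<Rightarrow> 'a \<Rightarrow> bool"
  where "eigenvector T e \<longleftrightarrow> e \<noteq> 0 \<and> (\<exists>\<mu>. T e = \<mu> *\<^sub>C e)"

definition nearly_strictly_convex :: "'a::real_normed_vector itself \<Rightarrow> bool"
  where "nearly_strictly_convex _ \<longleftrightarrow>
    (\<forall>C :: 'a set. convex C \<and> C \<subseteq> sphere 0 1 \<longrightarrow> totally_bounded C)"


subsection \<open>The dual space\<close>

typedef (overloaded) 'a cdual =
  "{f :: 'a::complex_normed_vector \<Rightarrow> complex. clinear f \<and> bounded_linear f}"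
  morphisms cdual_apply Abs_cdual
  by (rule exI[of _ "\<lambda>_. 0"]) (simp add: clinear_iff)

setup_lifting type_definition_cdual

instantiation cdual :: (complex_normed_vector) complex_normed_vector
begin

lift_definition norm_cdual :: "'a cdual \<Rightarrow> real" is onorm .

lift_definition zero_cdual :: "'a cdual" is "\<lambda>x. 0"
  by (simp add: clinear_iff)

lift_definition plus_cdual :: "'a cdual \<Rightarrow> 'a cdual \<Rightarrow> 'a cdual" is "\<lambda>f g x. f x + g x"
  by (auto simp: clinear_iff scaleC_complex_def algebra_simps intro: bounded_linear_add)

lift_definition minus_cdual :: "'a cdual \<Rightarrow> 'a cdual \<Rightarrow> 'a cdual" is "\<lambda>f g x. f x - g x"
  by (auto simp: clinear_iff scaleC_complex_def algebra_simps intro: bounded_linear_sub)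

lift_definition uminus_cdual :: "'a cdual \<Rightarrow> 'a cdual" is "\<lambda>f x. - f x"
  by (auto simp: clinear_iff scaleC_complex_def intro: bounded_linear_minus)

lift_definition scaleC_cdual :: "complex \<Rightarrow> 'a cdual \<Rightarrow> 'a cdual" is "\<lambda>c f x. c * f x"
  by (auto simp: clinear_iff scaleC_complex_def algebra_simps intro: bounded_linear_const_mult)

definition scaleR_cdual :: "real \<Rightarrow> 'a cdual \<Rightarrow> 'a cdual"
  where "scaleR_cdual r f = complex_of_real r *\<^sub>C f"

definition dist_cdual :: "'a cdual \<Rightarrow> 'a cdual \<Rightarrow> real"
  where "dist_cdual f g = norm (f - g)"

definition uniformity_cdual :: "('a cdual \<times> 'a cdual) filter"
  where "uniformity_cdual = (INF e\<in>{0 <..}. principal {(f, g). dist f g < e})"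

definition open_cdual :: "'a cdual set \<Rightarrow> bool"
  where "open_cdual S = (\<forall>f\<in>S. \<forall>\<^sub>F (f', g) in uniformity. f' = f \<longrightarrow> g \<in> S)"

definition sgn_cdual :: "'a cdual \<Rightarrow> 'a cdual"
  where "sgn_cdual f = inverse (norm f) *\<^sub>R f"

lemma onorm_cmult:
  fixes f :: "'b::real_normed_vector \<Rightarrow> complex"
  assumes "bounded_linear f"
  shows "onorm (\<lambda>x. c * f x) = cmod c * onorm f"
proof (rule antisym)
  have *: "onorm (\<lambda>x. d * g x) \<le> cmod d * onorm g"
    if "bounded_linear g" for d and g :: "'b \<Rightarrow> complex"
  proof (rule onorm_bound)
    show "0 \<le> cmod d * onorm g"
      using that by (simp add: onorm_pos_le)
    show "norm (d * g x) \<le> cmod d * onorm g * norm x" for x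
      using onorm[OF that, of x] by (simp add: norm_mult mult.assoc mult_left_mono)
  qed
  show "onorm (\<lambda>x. c * f x) \<le> cmod c * onorm f"
    using assms by (rule *)
  show "cmod c * onorm f \<le> onorm (\<lambda>x. c * f x)"
  proof (cases "c = 0")
    case False
    have "onorm (\<lambda>x. inverse c * (c * f x)) \<le> cmod (inverse c) * onorm (\<lambda>x. c * f x)"
      using assms by (intro * bounded_linear_const_mult)
    then have "onorm f \<le> inverse (cmod c) * onorm (\<lambda>x. c * f x)"
      using False by (simp add: norm_inverse mult.assoc[symmetric])
    then show ?thesis
      using False by (simp add: field_simps)
  qed (simp add: onorm_zero)
qed

instance
proof intro_classes
  fix f g h :: "'a cdual" and c d :: complex and r s :: real
  show "f + g + h = f + (g + h)"
    by transfer (simp add: algebra_simps)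
  show "f + g = g + f"
    by transfer (simp add: algebra_simps)
  show "0 + f = f"
    by transfer (simp add: algebra_simps)
  show "- f + f = 0"
    by transfer (simp add: algebra_simps)
  show "f - g = f + - g"
    by transfer (simp add: algebra_simps)
  show "c *\<^sub>C (f + g) = c *\<^sub>C f + c *\<^sub>C g"
    by transfer (simp add: algebra_simps)
  show "(c + d) *\<^sub>C f = c *\<^sub>C f + d *\<^sub>C f"
    by transfer (simp add: algebra_simps)
  show "c *\<^sub>C d *\<^sub>C f = (c * d) *\<^sub>C f"
    by transfer (simp add: algebra_simps)
  show "1 *\<^sub>C f = f"
    by transfer (simp add: algebra_simps)
  show "r *\<^sub>R f = complex_of_real r *\<^sub>C f"
    by (rule scaleR_cdual_def)
  show "norm (c *\<^sub>C f) = cmod c * norm f"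
    by transfer (simp add: onorm_cmult)
  show "r *\<^sub>R (f + g) = r *\<^sub>R f + r *\<^sub>R g"
    unfolding scaleR_cdual_def by transfer (simp add: algebra_simps)
  show "(r + s) *\<^sub>R f = r *\<^sub>R f + s *\<^sub>R f"
    unfolding scaleR_cdual_def by transfer (simp add: algebra_simps)
  show "r *\<^sub>R s *\<^sub>R f = (r * s) *\<^sub>R f"
    unfolding scaleR_cdual_def by transfer (simp add: algebra_simps)
  show "1 *\<^sub>R f = f"
    unfolding scaleR_cdual_def by transfer (simp add: algebra_simps)
  show "norm (r *\<^sub>R f) = \<bar>r\<bar> * norm f"
    unfolding scaleR_cdual_def by transfer (simp add: onorm_cmult)
  show "norm f = 0 \<longleftrightarrow> f = 0"
    by transfer (auto simp: onorm_eq_0)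
  show "norm (f + g) \<le> norm f + norm g"
    by transfer (auto intro: onorm_triangle)
  show "dist f g = norm (f - g)"
    by (rule dist_cdual_def)
  show "sgn f = inverse (norm f) *\<^sub>R f"
    by (rule sgn_cdual_def)
  show "(uniformity :: ('a cdual \<times> 'a cdual) filter) = (INF e\<in>{0 <..}. principal {(f, g). dist f g < e})"
    by (rule uniformity_cdual_def)
  show "open U \<longleftrightarrow> (\<forall>f\<in>U. \<forall>\<^sub>F (f', g) in uniformity. f' = f \<longrightarrow> g \<in> U)" for U :: "'a cdual set"
    by (rule open_cdual_def)
qed

end

definition weak_topology :: "'a::complex_normed_vector topology"
  where "weak_topology =
    topology_generated_by {cdual_apply \<nu> -` U | \<nu> U. open U}"

end

theory Submission
  imports Defs
begin

text \<open>Under each of the three conditions \<open>D\<close> is weakly connected, so it suffices that the eigenvalue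
  is locally constant on \<open>D\<close> for the weak topology. Let \<open>T e = c *\<^sub>C e\<close> with \<open>e \<noteq> 0\<close>; then \<open>\<bar>c\<bar> = 1\<close>. Telescoping the ergodic averages
  of the isometry \<open>c\<inverse> T\<close> shows that \<open>e\<close> has distance \<open>\<parallel>e\<parallel>\<close> from the range of \<open>T - c\<close>
  (\<open>norm_eigenvector_le_perturbed\<close>). Hahn--Banach therefore gives a bounded functional \<open>\<nu>\<close> with
  \<open>\<nu> e \<noteq> 0\<close> that vanishes on this range, that is, \<open>\<nu> (T x) = c \<nu> x\<close> for all \<open>x\<close>. Such a \<open>\<nu>\<close>
  vanishes at every eigenvector for an eigenvalue other than \<open>c\<close>, so the weakly open set where
  \<open>\<nu> \<noteq> 0\<close> contains \<open>e\<close> and, among the eigenvectors of \<open>T\<close>, only ones for \<open>c\<close>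
  (\<open>weak_neighbourhood_one_eigenvalue\<close>). Hence the eigenvalue is constant on \<open>D\<close>. The equation \<open>T x = c *\<^sub>C x\<close> passes from \<open>D\<close> to its closed linear span.

  The Hahn--Banach theorem is obtained from Zorn's lemma applied to sublinear functionals ordered
  pointwise: a minimal one is linear.\<close>

section \<open>The Hahn--Banach theorem for sublinear functionals\<close>

text \<open>Positive homogeneity is required as an inequality only: the converse inequality for \<open>t > 0\<close>
  follows by scaling back with \<open>1 / t\<close>.\<close>

definition sublinear :: "('a::real_vector \<Rightarrow> real) \<Rightarrow> bool"
  where "sublinear p \<longleftrightarrow>
    (\<forall>x y. p (x + y) \<le> p x + p y) \<and> (\<forall>t x. 0 \<le> t \<longrightarrow> p (t *\<^sub>R x) \<le> t * p x)"

lemma sublinearI: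
  assumes "\<And>x y. p (x + y) \<le> p x + p y" and "\<And>t x. 0 \<le> t \<Longrightarrow> p (t *\<^sub>R x) \<le> t * p x"
  shows "sublinear p"
  using assms by (auto simp: sublinear_def)

lemma sublinear_add: "sublinear p \<Longrightarrow> p (x + y) \<le> p x + p y"
  by (simp add: sublinear_def)

lemma sublinear_scaleR_le: "sublinear p \<Longrightarrow> 0 \<le> t \<Longrightarrow> p (t *\<^sub>R x) \<le> t * p x"
  by (simp add: sublinear_def)

lemma sublinear_zero:
  assumes "sublinear p"
  shows "p 0 = 0"
  using sublinear_add[OF assms, of 0 0] sublinear_scaleR_le[OF assms, of 0 0] by simp

lemma sublinear_scaleR:
  assumes "sublinear p" and "0 \<le> t"
  shows "p (t *\<^sub>R x) = t * p x"
proof (cases "t = 0")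
  case True
  then show ?thesis by (simp add: sublinear_zero[OF assms(1)])
next
  case False
  then have "t > 0" using assms(2) by simp
  have "p (inverse t *\<^sub>R t *\<^sub>R x) \<le> inverse t * p (t *\<^sub>R x)"
    using \<open>t > 0\<close> by (intro sublinear_scaleR_le[OF assms(1)]) simp
  then have "t * p x \<le> p (t *\<^sub>R x)"
    using \<open>t > 0\<close> by (simp add: field_simps)
  then show ?thesis
    using sublinear_scaleR_le[OF assms, of x] by simp
qed

lemma sublinear_minus_ge:
  assumes "sublinear p"
  shows "- p (- x) \<le> p x"
  using sublinear_add[OF assms, of x "- x"] sublinear_zero[OF assms] by simp

text \<open>An odd sublinear functional is linear, because oddness reverses both inequalities.\<close>

lemma sublinear_odd_imp_linear:
  fixes p :: "'a::real_vector \<Rightarrow> real"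
  assumes p: "sublinear p" and odd: "\<And>x. p (- x) = - p x"
  shows "linear p"
proof (rule linearI)
  fix x y :: 'a and t :: real
  have "p (- x + - y) \<le> p (- x) + p (- y)"
    by (rule sublinear_add[OF p])
  moreover have "p (- x + - y) = - p (x + y)"
    using odd[of "x + y"] by (simp add: algebra_simps)
  ultimately show "p (x + y) = p x + p y"
    using sublinear_add[OF p, of x y] odd by simp
  show "p (t *\<^sub>R x) = t *\<^sub>R p x"
  proof (cases "0 \<le> t")
    case True
    then show ?thesis by (simp add: sublinear_scaleR[OF p])
  next
    case False
    then have "p ((- t) *\<^sub>R x) = - t * p x"
      by (intro sublinear_scaleR[OF p]) simp
    then show ?thesis using odd[of "t *\<^sub>R x"] by simp
  qed
qed

text \<open>Lowering \<open>p\<close> along a convex cone \<open>C\<close> by a functional \<open>f\<close> that is dominated by \<open>p\<close> on \<open>C\<close>: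
  the result is the largest sublinear functional below \<open>p\<close> that is at most \<open>- f m\<close> at each \<open>- m\<close>
  with \<open>m \<in> C\<close>, so that every linear functional below it dominates \<open>f\<close> on \<open>C\<close>. Taking for \<open>C\<close> a
  subspace and \<open>f = 0\<close> gives the quotient seminorm; taking a ray and \<open>f = p\<close> forces oddness
  in the direction of the ray.\<close>

definition lowered :: "('a::real_vector \<Rightarrow> real) \<Rightarrow> ('a \<Rightarrow> real) \<Rightarrow> 'a set \<Rightarrow> 'a \<Rightarrow> real"
  where "lowered p f C x = (INF m\<in>C. p (x + m) - f m)"

locale dominated_on_cone =
  fixes p f :: "'a::real_vector \<Rightarrow> real" and C :: "'a set"
  assumes sublinear: "sublinear p"
    and cone_zero: "0 \<in> C"
    and cone_add: "\<And>m n. m \<in> C \<Longrightarrow> n \<in> C \<Longrightarrow> m + n \<in> C"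
    and cone_scaleR: "\<And>t m. 0 \<le> t \<Longrightarrow> m \<in> C \<Longrightarrow> t *\<^sub>R m \<in> C"
    and f_zero: "f 0 = 0"
    and f_add: "\<And>m n. m \<in> C \<Longrightarrow> n \<in> C \<Longrightarrow> f m + f n \<le> f (m + n)"
    and f_scaleR: "\<And>t m. 0 \<le> t \<Longrightarrow> m \<in> C \<Longrightarrow> t * f m \<le> f (t *\<^sub>R m)"
    and f_le: "\<And>m. m \<in> C \<Longrightarrow> f m \<le> p m"
begin

lemma lowered_le_at:
  assumes "m \<in> C"
  shows "lowered p f C x \<le> p (x + m) - f m"
  unfolding lowered_def
proof (rule cINF_lower[OF _ assms])
  show "bdd_below ((\<lambda>m. p (x + m) - f m) ` C)"
  proof (rule bdd_belowI2)
    fix m assume "m \<in> C"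
    then show "- p (- x) \<le> p (x + m) - f m"
      using f_le[of m] sublinear_add[OF sublinear, of "x + m" "- x"] by simp
  qed
qed

lemma lowered_greatest:
  assumes "\<And>m. m \<in> C \<Longrightarrow> b \<le> p (x + m) - f m"
  shows "b \<le> lowered p f C x"
  unfolding lowered_def using cone_zero assms by (intro cINF_greatest) auto

lemma lowered_le: "lowered p f C x \<le> p x"
  using lowered_le_at[OF cone_zero, of x] f_zero by simp

lemma lowered_minus_le:
  assumes "m \<in> C"
  shows "lowered p f C (- m) \<le> - f m"
  using lowered_le_at[OF assms, of "- m"] sublinear_zero[OF sublinear] by simp

lemma sublinear_lowered: "sublinear (lowered p f C)"
proof (rule sublinearI)
  fix x y :: 'a
  have split: "lowered p f C (x + y) \<le> (p (x + m) - f m) + (p (y + n) - f n)"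
    if "m \<in> C" "n \<in> C" for m n
  proof -
    have "lowered p f C (x + y) \<le> p ((x + m) + (y + n)) - f (m + n)"
      using lowered_le_at[OF cone_add[OF that], of "x + y"] by (simp add: algebra_simps)
    also have "\<dots> \<le> (p (x + m) - f m) + (p (y + n) - f n)"
      using sublinear_add[OF sublinear, of "x + m" "y + n"] f_add[OF that] by simp
    finally show ?thesis .
  qed
  have "lowered p f C (x + y) - (p (x + m) - f m) \<le> lowered p f C y"
    if "m \<in> C" for m
    by (rule lowered_greatest) (use split[OF that] in \<open>simp add: diff_le_eq add.commute\<close>)
  then have "lowered p f C (x + y) - lowered p f C y \<le> lowered p f C x"
    by (intro lowered_greatest) (simp add: algebra_simps)
  then show "lowered p f C (x + y) \<le> lowered p f C x + lowered p f C y"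
    by simp
next
  fix t :: real and x :: 'a
  assume "0 \<le> t"
  show "lowered p f C (t *\<^sub>R x) \<le> t * lowered p f C x"
  proof (cases "t = 0")
    case True
    then show ?thesis
      using lowered_le[of 0] sublinear_zero[OF sublinear] by simp
  next
    case False
    then have "t > 0" using \<open>0 \<le> t\<close> by simp
    have "lowered p f C (t *\<^sub>R x) / t \<le> p (x + m) - f m" if "m \<in> C" for m
    proof -
      have "lowered p f C (t *\<^sub>R x) \<le> p (t *\<^sub>R (x + m)) - f (t *\<^sub>R m)"
        using lowered_le_at[OF cone_scaleR[OF \<open>0 \<le> t\<close> that], of "t *\<^sub>R x"]
        by (simp add: scaleR_add_right)
      also have "\<dots> \<le> t * (p (x + m) - f m)"
        using sublinear_scaleR_le[OF sublinear \<open>0 \<le> t\<close>, of "x + m"] f_scaleR[OF \<open>0 \<le> t\<close> that]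
        by (simp add: algebra_simps)
      finally show ?thesis
        using \<open>t > 0\<close> by (simp add: field_simps)
    qed
    then have "lowered p f C (t *\<^sub>R x) / t \<le> lowered p f C x"
      by (rule lowered_greatest)
    then show ?thesis
      using \<open>t > 0\<close> by (simp add: field_simps)
  qed
qed

end

lemma dominated_on_ray:
  assumes p: "sublinear p"
  shows "dominated_on_cone p p {t *\<^sub>R y | t. 0 \<le> t}"
proof
  show "0 \<in> {t *\<^sub>R y | t. 0 \<le> t}"
    by (auto intro!: exI[of _ 0])
next
  fix m n assume "m \<in> {t *\<^sub>R y | t. 0 \<le> t}" "n \<in> {t *\<^sub>R y | t. 0 \<le> t}"
  then obtain s t where st: "m = s *\<^sub>R y" "0 \<le> s" "n = t *\<^sub>R y" "0 \<le> t" by blast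
  then have mn: "m + n = (s + t) *\<^sub>R y" by (simp add: scaleR_add_left)
  with st show "m + n \<in> {t *\<^sub>R y | t. 0 \<le> t}"
    using add_nonneg_nonneg by blast
  show "p m + p n \<le> p (m + n)"
    using st unfolding mn by (simp add: sublinear_scaleR[OF p] distrib_right)
next
  fix t :: real and m assume "0 \<le> t" "m \<in> {t *\<^sub>R y | t. 0 \<le> t}"
  then show "t *\<^sub>R m \<in> {t *\<^sub>R y | t. 0 \<le> t}"
    by (auto simp: mult_nonneg_nonneg)
qed (simp_all add: sublinear_scaleR[OF p] sublinear_zero[OF p] p)

text \<open>Zorn's lemma applies, since the pointwise infimum of a chain of sublinear functionals is
  again subadditive because, of any two members of the chain, one lies below the other; it is
  finite because every \<open>q \<le> p\<close> satisfies \<open>q x \<ge> - p (- x)\<close>.\<close>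

lemma exists_minimal_sublinear:
  fixes p :: "'a::real_vector \<Rightarrow> real"
  assumes p: "sublinear p"
  obtains q where "sublinear q" "q \<le> p" "\<And>r. sublinear r \<Longrightarrow> r \<le> q \<Longrightarrow> r = q"
proof -
  define A where "A = {q. sublinear q \<and> q \<le> p}"
  have "\<exists>m\<in>A. \<forall>a\<in>A. m \<ge> a \<longrightarrow> a = m"
  proof (rule predicate_Zorn)
    show "partial_order_on A (relation_of (\<ge>) A)"
      by (rule partial_order_on_relation_ofI) auto
  next
    fix C assume "C \<in> Chains (relation_of (\<ge>) A)"
    then have CA: "C \<subseteq> A" and chain: "\<And>q r. q \<in> C \<Longrightarrow> r \<in> C \<Longrightarrow> q \<le> r \<or> r \<le> q"
      by (auto simp: Chains_def relation_of_def)
    show "\<exists>u\<in>A. \<forall>a\<in>C. a \<ge> u"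
    proof (cases "C = {}")
      case True
      then show ?thesis using p by (auto simp: A_def)
    next
      case False
      define u where "u x = (INF q\<in>C. q x)" for x
      have sub: "sublinear q" and le_p: "q x \<le> p x" if "q \<in> C" for q x
        using that CA by (auto simp: A_def le_fun_def)
      have u_le: "u x \<le> q x" if "q \<in> C" for q x
        unfolding u_def
      proof (rule cINF_lower[OF _ that])
        show "bdd_below ((\<lambda>q. q x) ` C)"
        proof (rule bdd_belowI2)
          fix r assume "r \<in> C"
          then show "- p (- x) \<le> r x"
            using sublinear_minus_ge[OF sub, of r x] le_p[of r "- x"] by simp
        qed
      qed
      have u_greatest: "b \<le> u x" if "\<And>q. q \<in> C \<Longrightarrow> b \<le> q x" for b x
        unfolding u_def using False that by (intro cINF_greatest) auto
      have "sublinear u"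
      proof (rule sublinearI)
        fix x y
        have split: "u (x + y) \<le> q x + r y" if qr: "q \<in> C" "r \<in> C" for q r
        proof -
          from chain[OF qr] obtain s where s: "s \<in> C" "s x \<le> q x" "s y \<le> r y"
            using qr by (auto simp: le_fun_def)
          then show ?thesis
            using u_le[OF s(1), of "x + y"] sublinear_add[OF sub[OF s(1)], of x y] by simp
        qed
        have "u (x + y) - q x \<le> u y" if "q \<in> C" for q
          by (rule u_greatest) (use split[OF that] in \<open>simp add: diff_le_eq add.commute\<close>)
        then have "u (x + y) - u y \<le> u x"
          by (intro u_greatest) (simp add: algebra_simps)
        then show "u (x + y) \<le> u x + u y" by simp
      next
        fix t :: real and x assume t: "0 \<le> t"
        obtain q0 where q0: "q0 \<in> C" using False by blast
        show "u (t *\<^sub>R x) \<le> t * u x"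
        proof (cases "t = 0")
          case True
          then show ?thesis
            using u_le[OF q0, of 0] sublinear_zero[OF sub[OF q0]] by simp
        next
          case False
          then have "t > 0" using t by simp
          have "u (t *\<^sub>R x) / t \<le> q x" if "q \<in> C" for q
            using u_le[OF that, of "t *\<^sub>R x"] sublinear_scaleR[OF sub[OF that] t, of x] \<open>t > 0\<close>
            by (simp add: field_simps)
          then have "u (t *\<^sub>R x) / t \<le> u x" by (rule u_greatest)
          then show ?thesis using \<open>t > 0\<close> by (simp add: field_simps)
        qed
      qed
      moreover have "u \<le> p"
      proof (rule le_funI)
        fix x
        obtain q0 where "q0 \<in> C" using False by blast
        then show "u x \<le> p x" using u_le[of q0 x] le_p[of q0 x] by simp
      qed
      ultimately have "u \<in> A" by (simp add: A_def)
      then show ?thesis using u_le by (auto simp: le_fun_def)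
    qed
  qed
  then obtain q where q: "q \<in> A" "\<And>r. r \<in> A \<Longrightarrow> r \<le> q \<Longrightarrow> r = q" by blast
  show thesis
  proof (rule that[of q])
    show "sublinear q" "q \<le> p" using q(1) by (auto simp: A_def)
    show "r = q" if "sublinear r" "r \<le> q" for r
      using that q(1) by (intro q(2)) (auto simp: A_def)
  qed
qed

text \<open>A minimal sublinear functional cannot be lowered along any ray, hence is odd, hence linear.
  Lowering \<open>p\<close> along the ray of \<open>e\<close> before passing to a minimal functional fixes the value at \<open>e\<close>.\<close>

theorem hahn_banach_sublinear:
  fixes p :: "'a::real_vector \<Rightarrow> real"
  assumes p: "sublinear p"
  obtains \<phi> where "linear \<phi>" "\<And>x. \<phi> x \<le> p x" "\<phi> e = p e"
proof -
  let ?ray = "\<lambda>y. {t *\<^sub>R y | t. 0 \<le> t}"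
  have in_ray: "y \<in> ?ray y" for y :: 'a
    by (auto intro!: exI[of _ 1])
  interpret P: dominated_on_cone p p "?ray e"
    by (rule dominated_on_ray[OF p])
  obtain q where q: "sublinear q" "q \<le> lowered p p (?ray e)"
    and minimal: "\<And>r. sublinear r \<Longrightarrow> r \<le> q \<Longrightarrow> r = q"
    using exists_minimal_sublinear[OF P.sublinear_lowered] by blast
  have "q (- y) = - q y" for y
  proof -
    interpret Q: dominated_on_cone q q "?ray y"
      by (rule dominated_on_ray[OF q(1)])
    have "lowered q q (?ray y) = q"
      by (rule minimal[OF Q.sublinear_lowered]) (simp add: le_fun_def Q.lowered_le)
    then have "q (- y) \<le> - q y"
      using Q.lowered_minus_le[OF in_ray] by simp
    then show ?thesis
      using sublinear_minus_ge[OF q(1), of y] by simp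
  qed
  then have lin: "linear q" and odd: "q (- e) = - q e"
    using sublinear_odd_imp_linear[OF q(1)] by blast+
  have le: "q x \<le> p x" for x
    using q(2) P.lowered_le[of x] by (auto simp: le_fun_def intro: order_trans)
  moreover have "p e \<le> q e"
    using q(2) P.lowered_minus_le[OF in_ray] odd le_funD[OF q(2), of "- e"] by simp
  ultimately show thesis
    using that[OF lin] by (simp add: antisym)
qed

section \<open>Complex functionals\<close>

lemma bounded_linear_scaleC: "bounded_linear (\<lambda>x. c *\<^sub>C x)"
proof (rule bounded_linear_intro)
  show "c *\<^sub>C (r *\<^sub>R x) = r *\<^sub>R c *\<^sub>C x" for r and x :: 'a
    by (simp add: scaleR_scaleC scaleC_scaleC mult.commute)
  show "norm (c *\<^sub>C x) \<le> norm x * cmod c" for x :: 'a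
    by (simp add: norm_scaleC)
qed (rule scaleC_add_right)

text \<open>A real functional \<open>\<phi>\<close> is the real part of the complex functional \<open>\<phi> x - \<i> \<phi> (\<i> x)\<close>.\<close>

lemma complexify_functional:
  fixes \<phi> :: "'a::complex_normed_vector \<Rightarrow> real"
  assumes lin: "linear \<phi>" and bound: "\<And>x. \<bar>\<phi> x\<bar> \<le> norm x"
  obtains \<nu> :: "'a cdual" where "\<And>x. cdual_apply \<nu> x = Complex (\<phi> x) (- \<phi> (\<i> *\<^sub>C x))"
proof -
  let ?\<nu> = "\<lambda>x. Complex (\<phi> x) (- \<phi> (\<i> *\<^sub>C x))"
  have add: "?\<nu> (x + y) = ?\<nu> x + ?\<nu> y" for x y
    by (simp add: scaleC_add_right linear_add[OF lin] complex_eq_iff)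
  have scale: "?\<nu> (c *\<^sub>C x) = c * ?\<nu> x" for c x
  proof -
    have "c *\<^sub>C x = Re c *\<^sub>R x + Im c *\<^sub>R \<i> *\<^sub>C x"
      by (simp add: scaleR_scaleC scaleC_scaleC scaleC_add_left[symmetric] complex_eq_iff)
    moreover have "\<i> *\<^sub>C c *\<^sub>C x = Re c *\<^sub>R \<i> *\<^sub>C x - Im c *\<^sub>R x"
      by (simp add: scaleR_scaleC scaleC_scaleC complex_vector.scale_left_diff_distrib[symmetric]
          complex_eq_iff)
    ultimately show ?thesis
      by (simp add: linear_add[OF lin] linear_diff[OF lin] linear_cmul[OF lin] complex_eq_iff)
  qed
  have "clinear ?\<nu>"
    unfolding clinear_iff scaleC_complex_def using add scale by blast
  moreover have "bounded_linear ?\<nu>"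
  proof (rule bounded_linear_intro)
    show "?\<nu> (r *\<^sub>R x) = r *\<^sub>R ?\<nu> x" for r x
      using scale[of "complex_of_real r" x] by (simp add: scaleR_scaleC scaleC_complex_def)
    show "norm (?\<nu> x) \<le> norm x * 2" for x
      using cmod_le[of "?\<nu> x"] bound[of x] bound[of "\<i> *\<^sub>C x"] by (simp add: norm_scaleC)
  qed (rule add)
  ultimately have "cdual_apply (Abs_cdual ?\<nu>) = ?\<nu>"
    by (intro Abs_cdual_inverse) simp
  then show thesis
    using that[of "Abs_cdual ?\<nu>"] by simp
qed

text \<open>The distance to \<open>M\<close>, which is the norm lowered along \<open>M\<close> by \<open>0\<close>, is sublinear. A real
  functional below it that agrees with it at \<open>e\<close> vanishes on \<open>M\<close> but not at \<open>e\<close>; since \<open>M\<close> is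
  closed under multiplication by \<open>\<i>\<close>, so does its complexification.\<close>

lemma separate_point_from_subspace:
  fixes M :: "'a::complex_normed_vector set"
  assumes M: "complex_vector.subspace M"
    and "0 < d" and dist: "\<And>m. m \<in> M \<Longrightarrow> d \<le> norm (e + m)"
  obtains \<nu> :: "'a cdual" where "cdual_apply \<nu> e \<noteq> 0" "\<And>m. m \<in> M \<Longrightarrow> cdual_apply \<nu> m = 0"
proof -
  interpret dominated_on_cone norm "\<lambda>_. 0" M
  proof
    show "sublinear (norm :: 'a \<Rightarrow> real)"
      by (rule sublinearI) (simp_all add: norm_triangle_ineq)
  qed (use M in \<open>auto simp: complex_vector.subspace_def scaleR_scaleC\<close>)
  define p where "p = lowered norm (\<lambda>_. 0 :: real) M"
  obtain \<phi> where lin: "linear \<phi>" and le: "\<And>x. \<phi> x \<le> p x" and at_e: "\<phi> e = p e"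
    using hahn_banach_sublinear[OF sublinear_lowered, where e = e] unfolding p_def by blast
  have odd: "\<phi> (- x) = - \<phi> x" for x
    by (rule linear_neg[OF lin])
  have le_norm: "\<phi> x \<le> norm x" for x
    using le[of x] lowered_le[of x] by (simp add: p_def)
  have "\<bar>\<phi> x\<bar> \<le> norm x" for x
    using le_norm[of x] le_norm[of "- x"] odd[of x] by simp
  from complexify_functional[OF lin this]
  obtain \<nu> :: "'a cdual" where \<nu>: "\<And>x. cdual_apply \<nu> x = Complex (\<phi> x) (- \<phi> (\<i> *\<^sub>C x))"
    by blast
  have minus: "- m \<in> M" if "m \<in> M" for m
    using complex_vector.subspace_neg[OF M that] .
  have zero: "\<phi> m = 0" if "m \<in> M" for m
  proof -
    have "\<phi> (- n) \<le> 0" if "n \<in> M" for n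
      using le[of "- n"] lowered_minus_le[OF that] by (simp add: p_def)
    from this[OF that] this[OF minus[OF that]] show ?thesis
      using odd[of m] by simp
  qed
  show thesis
  proof (rule that)
    have "d \<le> p e"
      unfolding p_def by (rule lowered_greatest) (simp add: dist)
    then have "\<phi> e \<noteq> 0" using \<open>0 < d\<close> at_e by simp
    then show "cdual_apply \<nu> e \<noteq> 0" by (simp add: \<nu> complex_eq_iff)
    show "cdual_apply \<nu> m = 0" if "m \<in> M" for m
      using that complex_vector.subspace_scale[OF M that, of \<i>]
      by (simp add: \<nu> zero complex_eq_iff)
  qed
qed

section \<open>Eigenvectors of isometries in the weak topology\<close>

lemma openin_weak_vimage: "open U \<Longrightarrow> openin weak_topology (cdual_apply \<nu> -` U)"
  unfolding weak_topology_def by (rule topology_generated_by_Basis) blast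

lemma connectedin_weak_if_connected:
  fixes D :: "'a::complex_normed_vector set"
  assumes "connected D"
  shows "connectedin weak_topology D"
proof -
  have cont: "continuous_on UNIV (cdual_apply \<nu>)" for \<nu> :: "'a cdual"
    using cdual_apply[of \<nu>] by (auto intro: linear_continuous_on)
  have "continuous_map euclidean (weak_topology :: 'a topology) id"
    unfolding weak_topology_def
  proof (rule continuous_on_generated_topo)
    fix V :: "'a set" assume "V \<in> {cdual_apply \<nu> -` U | \<nu> U. open U}"
    then show "openin euclidean (id -` V \<inter> topspace euclidean)"
      by (auto intro!: open_vimage cont)
  next
    have "(UNIV :: 'a set) \<in> {cdual_apply \<nu> -` U | \<nu> U. open U}"
      by (auto intro!: exI[of _ UNIV])
    then show "id ` topspace euclidean \<subseteq> \<Union>{cdual_apply (\<nu> :: 'a cdual) -` U | \<nu> U. open U}"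
      by blast
  qed
  then show ?thesis
    using connectedin_continuous_map_image[of euclidean weak_topology id D] assms
    by (simp add: connectedin_iff_connected)
qed

text \<open>For the isometry \<open>S = c\<inverse> T\<close> and \<open>h = c g\<close>, the perturbation is \<open>S h - h\<close> and \<open>S e = e\<close>, so the
  sum of \<open>S\<^sup>k (e + S h - h)\<close> over \<open>k < n\<close> telescopes to \<open>n e + S\<^sup>n h - h\<close>. Taking norms gives
  \<open>n \<parallel>e\<parallel> \<le> n \<parallel>e + S h - h\<parallel> + 2 \<parallel>h\<parallel>\<close> for all \<open>n\<close>, and the last term is negligible after division
  by \<open>n\<close>.\<close>

lemma norm_eigenvector_le_perturbed:
  fixes T :: "'a::complex_normed_vector \<Rightarrow> 'a"
  assumes T: "clinear T" and iso: "\<And>x. norm (T x) = norm x"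
    and eig: "T e = c *\<^sub>C e" and c: "cmod c = 1"
  shows "norm e \<le> norm (e + (T g - c *\<^sub>C g))"
proof -
  define S where "S x = inverse c *\<^sub>C T x" for x
  define h where "h = c *\<^sub>C g"
  define y where "y = e + (S h - h)"
  have c0: "c \<noteq> 0" using c by auto
  have add: "S (u + v) = S u + S v" and norm_S: "norm (S u) = norm u"
    and smult: "S (r *\<^sub>R u) = r *\<^sub>R S u" for u v r
    using T c by (simp_all add: S_def clinear_iff scaleC_add_right norm_scaleC iso norm_inverse
        scaleR_scaleC scaleC_scaleC mult.commute)
  have linS: "linear S"
    by (rule linearI) (rule add smult)+
  have Se: "S e = e"
    using c0 by (simp add: S_def eig scaleC_scaleC scaleC_one)
  have "S h = T g"
    using T c0 by (simp add: S_def h_def clinear_iff scaleC_scaleC scaleC_one)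
  then have y: "y = e + (T g - c *\<^sub>C g)"
    by (simp add: y_def h_def)
  have norm_pow: "norm ((S ^^ n) h) = norm h" for n
    by (induction n) (simp_all add: norm_S)
  have sum_le: "norm (real n *\<^sub>R e + (S ^^ n) h - h) \<le> real n * norm y" for n
  proof (induction n)
    case 0
    then show ?case by simp
  next
    case (Suc n)
    have "real (Suc n) *\<^sub>R e + (S ^^ Suc n) h - h = S (real n *\<^sub>R e + (S ^^ n) h - h) + y"
      by (simp add: y_def add linear_diff[OF linS] smult Se algebra_simps)
    also have "norm \<dots> \<le> norm (real n *\<^sub>R e + (S ^^ n) h - h) + norm y"
      using norm_triangle_ineq[of "S (real n *\<^sub>R e + (S ^^ n) h - h)" y] by (simp add: norm_S)
    finally show ?case using Suc.IH by (simp add: algebra_simps)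
  qed
  have "real n * (norm e - norm y) \<le> 2 * norm h" for n
  proof -
    have "real n * norm e = norm (real n *\<^sub>R e)" by simp
    also have "\<dots> = norm ((real n *\<^sub>R e + (S ^^ n) h - h) + (h - (S ^^ n) h))" by simp
    also have "\<dots> \<le> norm (real n *\<^sub>R e + (S ^^ n) h - h) + norm (h - (S ^^ n) h)"
      by (rule norm_triangle_ineq)
    also have "\<dots> \<le> real n * norm y + 2 * norm h"
      using sum_le[of n] norm_triangle_ineq4[of h "(S ^^ n) h"] norm_pow[of n] by simp
    finally show ?thesis by (simp add: algebra_simps)
  qed
  then have "\<not> 0 < norm e - norm y"
    using reals_Archimedean3[of "norm e - norm y"] by (meson not_le)
  then show ?thesis by (simp add: y)
qed

text \<open>A functional \<open>\<nu>\<close> that vanishes on the range of \<open>T - c\<close> is an eigenvector of the adjoint of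
  \<open>T\<close>: if \<open>T x = \<mu> *\<^sub>C x\<close>, then \<open>\<mu> \<nu> x = \<nu> (T x) = c \<nu> x\<close>, so \<open>\<nu> x \<noteq> 0\<close> forces \<open>\<mu> = c\<close>. The
  preceding inequality allows \<open>\<nu> e \<noteq> 0\<close>, and the neighbourhood is the set where \<open>\<nu> \<noteq> 0\<close>.\<close>

lemma weak_neighbourhood_one_eigenvalue:
  fixes T :: "'a::complex_normed_vector \<Rightarrow> 'a"
  assumes T: "clinear T" and iso: "\<And>x. norm (T x) = norm x"
    and eig: "T e = c *\<^sub>C e" and "e \<noteq> 0"
  obtains W where "openin weak_topology W" "e \<in> W"
    "\<And>x \<mu>. x \<in> W \<Longrightarrow> T x = \<mu> *\<^sub>C x \<Longrightarrow> \<mu> = c"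
proof -
  let ?M = "range (\<lambda>g. T g - c *\<^sub>C g)"
  have c: "cmod c = 1"
    using iso[of e] \<open>e \<noteq> 0\<close> by (simp add: eig norm_scaleC)
  have M: "complex_vector.subspace ?M"
    unfolding complex_vector.subspace_def
  proof (intro conjI ballI allI)
    have "T 0 - c *\<^sub>C 0 = 0"
      using iso[of 0] by simp
    then show "0 \<in> ?M" by (intro image_eqI[of _ _ 0]) simp_all
  next
    fix m n assume "m \<in> ?M" "n \<in> ?M"
    then obtain g h where "m = T g - c *\<^sub>C g" "n = T h - c *\<^sub>C h" by blast
    then have "m + n = T (g + h) - c *\<^sub>C (g + h)"
      using T by (simp add: clinear_iff scaleC_add_right)
    then show "m + n \<in> ?M" by blast
  next
    fix b m assume "m \<in> ?M"
    then obtain g where "m = T g - c *\<^sub>C g" by blast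
    then have "b *\<^sub>C m = T (b *\<^sub>C g) - c *\<^sub>C b *\<^sub>C g"
      using T by (simp add: clinear_iff complex_vector.scale_right_diff_distrib scaleC_scaleC
          mult.commute)
    then show "b *\<^sub>C m \<in> ?M" by blast
  qed
  have "norm e \<le> norm (e + m)" if "m \<in> ?M" for m
    using that norm_eigenvector_le_perturbed[OF T iso eig c] by blast
  then obtain \<nu> :: "'a cdual" where at_e: "cdual_apply \<nu> e \<noteq> 0"
    and zero: "\<And>m. m \<in> ?M \<Longrightarrow> cdual_apply \<nu> m = 0"
    using separate_point_from_subspace[OF M, of "norm e" e] \<open>e \<noteq> 0\<close>
    by (metis zero_less_norm_iff)
  show thesis
  proof (rule that)
    show "openin weak_topology (cdual_apply \<nu> -` (- {0}))"
      by (rule openin_weak_vimage) (simp add: open_Compl)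
    show "e \<in> cdual_apply \<nu> -` (- {0})"
      using at_e by simp
    fix x \<mu> assume x: "x \<in> cdual_apply \<nu> -` (- {0})" and "T x = \<mu> *\<^sub>C x"
    then have "T x - c *\<^sub>C x = (\<mu> - c) *\<^sub>C x"
      by (simp add: complex_vector.scale_left_diff_distrib)
    moreover have "cdual_apply \<nu> ((\<mu> - c) *\<^sub>C x) = (\<mu> - c) * cdual_apply \<nu> x"
      using cdual_apply[of \<nu>] by (simp add: clinear_iff scaleC_complex_def)
    ultimately have "(\<mu> - c) * cdual_apply \<nu> x = 0"
      using zero[OF rangeI, of x] by simp
    then show "\<mu> = c" using x by simp
  qed
qed

lemma weakly_connected_eigenvectors_same_eigenvalue:
  fixes T :: "'a::complex_normed_vector \<Rightarrow> 'a"
  assumes T: "clinear T" and iso: "\<And>x. norm (T x) = norm x"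
    and eigs: "\<And>e. e \<in> D \<Longrightarrow> eigenvector T e"
    and conn: "connectedin weak_topology D"
  obtains c where "cmod c = 1" "\<And>x. x \<in> D \<Longrightarrow> T x = c *\<^sub>C x"
proof (cases "D = {}")
  case True
  then show thesis using that[of 1] by simp
next
  case False
  then obtain a where a: "a \<in> D" by blast
  then obtain c where "a \<noteq> 0" and Ta: "T a = c *\<^sub>C a"
    using eigs by (auto simp: eigenvector_def)
  then have "cmod c = 1"
    using iso[of a] by (simp add: norm_scaleC)
  moreover have "T x = c *\<^sub>C x" if "x \<in> D" for x
  proof (rule ccontr)
    assume x: "T x \<noteq> c *\<^sub>C x"
    \<comment> \<open>\<open>A\<close> and \<open>D - A\<close> are relatively weakly open in \<open>D\<close> and nonempty, so they disconnect \<open>D\<close>.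
      \<open>?I B\<close> is the largest weakly open set that meets \<open>D\<close> only inside \<open>B\<close>.\<close>
    define A where "A = {y \<in> D. T y = c *\<^sub>C y}"
    let ?I = "\<lambda>B. \<Union>{W. openin weak_topology W \<and> W \<inter> D \<subseteq> B}"
    have nbh: "\<exists>W. openin weak_topology W \<and> y \<in> W \<and> (W \<inter> D \<subseteq> A \<or> W \<inter> D \<subseteq> D - A)"
      if "y \<in> D" for y
    proof -
      obtain b where "y \<noteq> 0" "T y = b *\<^sub>C y"
        using eigs \<open>y \<in> D\<close> by (auto simp: eigenvector_def)
      then obtain W where W: "openin weak_topology W" "y \<in> W"
        and eq: "\<And>z \<mu>. z \<in> W \<Longrightarrow> T z = \<mu> *\<^sub>C z \<Longrightarrow> \<mu> = b"
        using weak_neighbourhood_one_eigenvalue[OF T iso, of y b thesis] by blast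
      have Tz: "T z = b *\<^sub>C z" if "z \<in> W \<inter> D" for z
        using that eigs[of z] eq[of z] by (auto simp: eigenvector_def)
      have "W \<inter> D \<subseteq> A \<or> W \<inter> D \<subseteq> D - A"
      proof (cases "b = c")
        case True
        then show ?thesis using Tz by (auto simp: A_def)
      next
        case False
        then show ?thesis using eq by (auto simp: A_def)
      qed
      then show ?thesis using W by blast
    qed
    have op: "openin weak_topology (?I B)" for B :: "'a set"
      by (rule openin_Union) blast
    have cover: "D \<subseteq> ?I A \<union> ?I (D - A)"
    proof
      fix y assume "y \<in> D"
      from nbh[OF this] show "y \<in> ?I A \<union> ?I (D - A)" by blast
    qed
    have disj: "?I A \<inter> ?I (D - A) \<inter> D = {}"
      by blast
    have aA: "a \<in> A" and xA: "x \<in> D - A"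
      using a Ta \<open>x \<in> D\<close> x by (auto simp: A_def)
    have "a \<in> ?I A" "x \<in> ?I (D - A)"
      using nbh[OF a] nbh[OF \<open>x \<in> D\<close>] aA xA a by blast+
    then have "?I A \<inter> D \<noteq> {}" "?I (D - A) \<inter> D \<noteq> {}"
      using a \<open>x \<in> D\<close> by blast+
    then show False
      using conn op[of A] op[of "D - A"] cover disj unfolding connectedin
      by (metis (no_types, lifting))
  qed
  ultimately show thesis by (rule that)
qed

theorem theorem4p3:
  fixes T :: "'a::complex_normed_vector \<Rightarrow> 'a" and D :: "'a set"
  assumes "clinear T"
    and "\<And>x y. dist (T x) (T y) = dist x y"
    and "\<And>e. e \<in> D \<Longrightarrow> eigenvector T e"
    and "closure (cspan D) = UNIV"
    and "connected D
      \<or> (connectedin weak_topology D \<and>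
          (\<forall>e\<in>D. finite_dimensional
            {\<nu> \<in> cball (0 :: 'a cdual) 1. cdual_apply \<nu> e = complex_of_real (norm e)}))
      \<or> (bounded D \<and> connectedin weak_topology D \<and>
          separable_space (euclidean :: 'a cdual topology) \<and>
          nearly_strictly_convex TYPE('a cdual))"
  shows "\<exists>c::complex. cmod c = 1 \<and> T = (\<lambda>x. c *\<^sub>C x)"
proof -
  have add: "T (x + y) = T x + T y" and scale: "T (b *\<^sub>C x) = b *\<^sub>C T x" for x y b
    using assms(1) by (simp_all add: clinear_iff)
  have "T 0 = 0"
    using add[of 0 0] by simp
  then have iso: "norm (T x) = norm x" for x
    using assms(2)[of x 0] by (simp add: dist_norm)
  have "connectedin weak_topology D"
    using assms(5) connectedin_weak_if_connected by blast
  then obtain c where c: "cmod c = 1" and on_D: "\<And>x. x \<in> D \<Longrightarrow> T x = c *\<^sub>C x"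
    using weakly_connected_eigenvectors_same_eigenvalue[OF assms(1) iso assms(3)] by blast
  let ?K = "{x. T x = c *\<^sub>C x}"
  have "complex_vector.subspace ?K"
    by (auto simp: complex_vector.subspace_def \<open>T 0 = 0\<close> add scale scaleC_add_right scaleC_scaleC
        mult.commute)
  then have "cspan D \<subseteq> ?K"
    using on_D by (intro complex_vector.span_minimal) auto
  moreover have "closed ?K"
  proof (rule closed_Collect_eq)
    have "bounded_linear T"
      by (rule bounded_linear_intro[where K = 1])
        (simp_all add: add scale scaleR_scaleC iso)
    then show "continuous_on UNIV T"
      by (rule linear_continuous_on)
    show "continuous_on UNIV (\<lambda>x. c *\<^sub>C x)"
      by (rule linear_continuous_on[OF bounded_linear_scaleC])
  qed
  ultimately have "?K = UNIV"
    using closure_minimal assms(4) by blast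
  then show ?thesis
    using c by blast
qed

end
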